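(* Let $\lambda$ be a nonzero real number and $Y$ a random variable as in the context. For all integers $n\ge k\ge0$, \[ G_{\lambda}^{Y}(n,k)=B_{n,k}\big(-\beta_{0,\lambda}^{(1,-Y)},-\beta_{1,\lambda}^{(2,-Y)},\dots,-\beta_{n-k,\lambda}^{(n-k+1,-Y)}\big) =B_{n,k}\big(\beta_{0,-\lambda}^{(1,Y)},\beta_{1,-\lambda}^{(2,Y)},\dots,\beta_{n-k,-\lambda}^{(n-k+1,Y)}\big) \] \[ =(-1)^k\binom{n-1}{k-1}\beta_{n-k,\lambda}^{(n,-Y)}=(-1)^kS_{1,\lambda}^{-Y}(n,k)=\binom{n-1}{k-1}\beta_{n-k,-\lambda}^{(n,Y)}=S_{1,-\lambda}^{Y}(n,k). \]
   Context: For a nonzero real $\mu$: $(x)_{0,\mu}=1$, $(x)_{n,\mu}=x(x-\mu)\cdots(x-(n-1)\mu)$ for $n\ge1$. $Y$ is a random variable whose moment-generating function $E[e^{tY}]$ exists for $|t|<r$ for some $r>0$, and $E[Y]\neq0$. For $X\in\{Y,-Y\}$ and nonzero real $\mu$, $E[e_{\mu}^{X}(t)]$ denotes the formal power series $\sum_{n\ge0}E[(X)_{n,\mu}]\frac{t^n}{n!}$; then $e_{X,\mu}(t):=E[e_{\mu}^{X}(t)]-1$ is a delta series (constant term $0$, linear coefficient $E[X]\ne0$), and $\bar e_{X,\mu}(t)$ denotes its compositional inverse. The probabilistic degenerate Stirling numbers of the first kind are defined by $\frac1{k!}\big(\bar e_{X,\mu}(t)\big)^k=\sum_{n\ge k}S_{1,\mu}^{X}(n,k)\frac{t^n}{n!}$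 ($k\ge0$). The probabilistic degenerate Bernoulli numbers of order $\gamma$ are defined by $\big(\frac{t}{E[e_{\mu}^{X}(t)]-1}\big)^{\gamma}=\sum_{n\ge0}\beta_{n,\mu}^{(\gamma,X)}\frac{t^n}{n!}$. Let $\mathcal{E}_{Y,\lambda}(t)=E[e_{-\lambda}^{Y}(t)]-1$ (which equals the series $E[e_{\lambda}^{-Y}(-t)]-1$), with compositional inverse $\bar{\mathcal{E}}_{Y,\lambda}(t)$; the probabilistic heterogeneous Stirling numbers of the first kind are defined by $\frac1{k!}\big(\bar{\mathcal E}_{Y,\lambda}(t)\big)^k=\sum_{n\ge k}G_{\lambda}^{Y}(n,k)\frac{t^n}{n!}$ ($k\ge0$). The partial Bell polynomials $B_{n,k}$ are defined by $\frac{1}{k!}\big(\sum_{m\ge1}x_m\frac{t^m}{m!}\big)^k=\sum_{n\ge k}B_{n,k}(x_1,\dots,x_{n-k+1})\frac{t^n}{n!}$. Binomial coefficients with $k=0$ follow the convention $\binom{n-1}{-1}=\delta_{n,0}$. *)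

theory Defs
  imports "HOL-Probability.Probability" "HOL-Computational_Algebra.Formal_Power_Series"
begin

definition deg_ffact :: "real \<Rightarrow> real \<Rightarrow> nat \<Rightarrow> real" where
  "deg_ffact \<mu> x n = (\<Prod>i<n. x - real i * \<mu>)"

definition has_mgf :: "'a measure \<Rightarrow> ('a \<Rightarrow> real) \<Rightarrow> bool" where
  "has_mgf M X \<longleftrightarrow> (\<exists>r>0. \<forall>t. \<bar>t\<bar> < r \<longrightarrow> integrable M (\<lambda>\<omega>. exp (t * X \<omega>)))"

text \<open>The formal power series \<open>E[e\<^sub>\<mu>\<^sup>X(t)]\<close>.\<close>

definition exp_deg_fps :: "'a measure \<Rightarrow> ('a \<Rightarrow> real) \<Rightarrow> real \<Rightarrow> real fps" where
  "exp_deg_fps M X \<mu> = Abs_fps (\<lambda>n. (LINT \<omega>|M. deg_ffact \<mu> (X \<omega>) n) / fact n)"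

definition delta_fps :: "'a measure \<Rightarrow> ('a \<Rightarrow> real) \<Rightarrow> real \<Rightarrow> real fps" where
  "delta_fps M X \<mu> = exp_deg_fps M X \<mu> - 1"

text \<open>\<^const>\<open>fps_inv\<close> is the compositional, not the multiplicative, inverse.\<close>

definition prob_deg_stirling1 ::
    "'a measure \<Rightarrow> ('a \<Rightarrow> real) \<Rightarrow> real \<Rightarrow> nat \<Rightarrow> nat \<Rightarrow> real" where
  "prob_deg_stirling1 M X \<mu> n k =
     fact n * fps_nth (fps_const (1 / fact k) * fps_inv (delta_fps M X \<mu>) ^ k) n"

text \<open>
  Argument order: \<open>prob_deg_bernoulli M X \<mu> \<gamma> n\<close> is \<open>\<beta>\<close> with lower indices \<open>n\<close>, \<open>\<mu>\<close> and order \<open>\<gamma>\<close>.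
  The quotient is an honest power series with constant term \<open>1 / E[X]\<close>, as the denominator has
  subdegree one. Only orders in the natural numbers are covered.
\<close>

definition prob_deg_bernoulli ::
    "'a measure \<Rightarrow> ('a \<Rightarrow> real) \<Rightarrow> real \<Rightarrow> nat \<Rightarrow> nat \<Rightarrow> real" where
  "prob_deg_bernoulli M X \<mu> \<gamma> n =
     fact n * fps_nth ((fps_X / (exp_deg_fps M X \<mu> - 1)) ^ \<gamma>) n"

definition het_delta_fps :: "'a measure \<Rightarrow> ('a \<Rightarrow> real) \<Rightarrow> real \<Rightarrow> real fps" where
  "het_delta_fps M Y lam = exp_deg_fps M Y (- lam) - 1"

definition prob_het_stirling1 ::
    "'a measure \<Rightarrow> ('a \<Rightarrow> real) \<Rightarrow> real \<Rightarrow> nat \<Rightarrow> nat \<Rightarrow> real" where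
  "prob_het_stirling1 M Y lam n k =
     fact n * fps_nth (fps_const (1 / fact k) * fps_inv (het_delta_fps M Y lam) ^ k) n"

text \<open>
  The partial Bell polynomial takes the whole sequence \<open>x\<close> as its argument; \<open>x 0\<close> is ignored, and
  by \<open>partial_bell_cong\<close> below only \<open>x 1, \<dots>, x (n - k + 1)\<close> matter.
\<close>

definition partial_bell :: "nat \<Rightarrow> nat \<Rightarrow> (nat \<Rightarrow> real) \<Rightarrow> real" where
  "partial_bell n k x =
     fact n * fps_nth (fps_const (1 / fact k) *
       Abs_fps (\<lambda>m. if m = 0 then 0 else x m / fact m) ^ k) n"

text \<open>The binomial coefficient \<open>n - 1\<close> over \<open>k - 1\<close>, with \<open>\<delta>\<^bsub>n,0\<^esub>\<close> as its value at \<open>k = 0\<close>.\<close>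

definition binom_pred :: "nat \<Rightarrow> nat \<Rightarrow> nat" where
  "binom_pred n k = (if k = 0 then (if n = 0 then 1 else 0) else (n - 1) choose (k - 1))"

lemma fps_power_nth_cong:
  fixes f g :: "real fps"
  assumes "\<And>i. i \<le> m \<Longrightarrow> fps_nth f i = fps_nth g i"
  shows "i \<le> m \<Longrightarrow> fps_nth (f ^ k) i = fps_nth (g ^ k) i"
  by (induction k arbitrary: i) (auto simp: fps_mult_nth assms intro!: sum.cong)

lemma partial_bell_cong:
  assumes "k \<le> n" and "\<And>m. 1 \<le> m \<Longrightarrow> m \<le> n - k + 1 \<Longrightarrow> x m = y m"
  shows "partial_bell n k x = partial_bell n k y"
proof -
  define F :: "(nat \<Rightarrow> real) \<Rightarrow> real fps"
    where "F = (\<lambda>x. Abs_fps (\<lambda>m. if m = 0 then 0 else x m / fact m))"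
  define H :: "(nat \<Rightarrow> real) \<Rightarrow> real fps"
    where "H = (\<lambda>x. Abs_fps (\<lambda>m. x (Suc m) / fact (Suc m)))"
  have F: "F z = fps_X * H z" for z
    by (rule fps_ext) (auto simp: F_def H_def gr0_conv_Suc)
  have "fps_nth (H x ^ k) (n - k) = fps_nth (H y ^ k) (n - k)"
    by (rule fps_power_nth_cong[where m = "n - k"]) (auto simp: H_def assms)
  then have "fps_nth (F x ^ k) n = fps_nth (F y ^ k) n"
    using assms(1) by (simp add: F power_mult_distrib fps_X_power_mult_nth)
  then show ?thesis
    by (simp add: partial_bell_def F_def)
qed

lemma delta_fps_nth_0:
  "prob_space M \<Longrightarrow> fps_nth (delta_fps M X \<mu>) 0 = 0"
  by (simp add: delta_fps_def exp_deg_fps_def deg_ffact_def prob_space.prob_space)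

lemma delta_fps_nth_1:
  "fps_nth (delta_fps M X \<mu>) 1 = (LINT \<omega>|M. X \<omega>)"
  by (simp add: delta_fps_def exp_deg_fps_def deg_ffact_def)

lemma exp_deg_fps_uminus:
  "exp_deg_fps M Y (- lam) = exp_deg_fps M (\<lambda>\<omega>. - Y \<omega>) lam oo (- fps_X)"
proof (rule fps_ext)
  fix n
  have "deg_ffact (- lam) y n = (- 1) ^ n * deg_ffact lam (- y) n" for y
    by (induction n) (auto simp: deg_ffact_def algebra_simps)
  then show "fps_nth (exp_deg_fps M Y (- lam)) n =
      fps_nth (exp_deg_fps M (\<lambda>\<omega>. - Y \<omega>) lam oo (- fps_X)) n"
    by (simp add: exp_deg_fps_def fps_compose_uminus')
qed

end

theory Submission
  imports Defs
begin

text \<open>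
  The theorem is Lagrange inversion. Let \<open>a\<close> be a delta series with compositional inverse \<open>f\<close>, and
  put \<open>\<phi> = X / a\<close>. Differentiating \<open>f\<^sup>k(a) = X\<^sup>k\<close>, multiplying by \<open>\<phi>\<^sup>n\<close> and comparing the
  coefficients of \<open>X\<^sup>n\<^sup>-\<^sup>1\<close> gives \<open>n [X\<^sup>n] f\<^sup>k = k [X\<^sup>n\<^sup>-\<^sup>k] \<phi>\<^sup>n\<close>. This is the binomial formula; its case
  \<open>k = 1\<close> identifies \<open>f\<close> with the generating function of the arguments of the Bell polynomial. The
  statements for \<open>- Y\<close> follow because \<open>a(-X)\<close> has compositional inverse \<open>- f\<close>.
\<close>

text \<open>Since \<open>a\<close> has no constant term, \<open>a ^ i\<close> has no terms below
  degree \<open>i\<close>. Hence all coefficients of the composition up to \<open>n\<close> are sums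
  over the same range \<open>i \<le> n\<close>, and the two finite sums can be exchanged.\<close>

lemma fps_compose_mult_nth:
  fixes a g h :: "'a::field fps"
  assumes "fps_nth a 0 = 0"
  shows "fps_nth ((g oo a) * h) n = (\<Sum>i\<le>n. fps_nth g i * fps_nth (a ^ i * h) n)"
proof -
  have *: "fps_nth (g oo a) m = (\<Sum>i\<le>n. fps_nth g i * fps_nth (a ^ i) m)" if "m \<le> n" for m
    unfolding fps_compose_nth
    by (rule sum.mono_neutral_left) (use that startsby_zero_power_prefix[OF assms] in auto)
  have "fps_nth ((g oo a) * h) n =
      (\<Sum>m\<le>n. \<Sum>i\<le>n. fps_nth g i * fps_nth (a ^ i) m * fps_nth h (n - m))"
    by (simp add: fps_mult_nth * sum_distrib_right atLeast0AtMost)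
  also have "\<dots> = (\<Sum>i\<le>n. \<Sum>m\<le>n. fps_nth g i * fps_nth (a ^ i) m * fps_nth h (n - m))"
    by (rule sum.swap)
  also have "\<dots> = (\<Sum>i\<le>n. fps_nth g i * fps_nth (a ^ i * h) n)"
    by (simp add: fps_mult_nth sum_distrib_left mult.assoc atLeast0AtMost)
  finally show ?thesis .
qed

text \<open>
  This is the coefficient form of ``the residue of \<open>a' a\<^sup>i / a\<^sup>n\<^sup>+\<^sup>1\<close> is \<open>\<delta>\<^bsub>i,n\<^esub>\<close>'', where \<open>\<phi> = X / a\<close>
  replaces the negative powers of \<open>a\<close>.
\<close>

lemma fps_residue_power_deriv:
  fixes a \<phi> :: "'a::field_char_0 fps"
  assumes a0: "fps_nth a 0 = 0" and \<phi>: "\<phi> * a = fps_X" and "i \<le> n"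
  shows "fps_nth (a ^ i * (fps_deriv a * \<phi> ^ Suc n)) n = (if i = n then 1 else 0)"
proof -
  obtain j where n: "n = i + j"
    using \<open>i \<le> n\<close> le_Suc_ex by blast
  have "fps_deriv (\<phi> * a) = 1"
    by (simp add: \<phi>)
  then have deriv: "\<phi> * fps_deriv a = 1 - fps_deriv \<phi> * a"
    by (simp add: algebra_simps)
  \<comment> \<open>Of the \<open>Suc n\<close> factors \<open>\<phi>\<close>, \<open>i\<close> turn
    \<open>a ^ i\<close> into \<open>fps_X ^ i\<close>, one pairs with \<open>fps_deriv a\<close>,
    and \<open>j\<close> remain.\<close>
  have "a ^ i * (fps_deriv a * \<phi> ^ Suc n) = (\<phi> * a) ^ i * (\<phi> ^ j * (\<phi> * fps_deriv a))"
    by (simp add: n power_add power_mult_distrib mult_ac)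
  also have "\<dots> = fps_X ^ i * (\<phi> ^ j * (1 - fps_deriv \<phi> * a))"
    by (simp add: \<phi> deriv)
  finally have *: "fps_nth (a ^ i * (fps_deriv a * \<phi> ^ Suc n)) n =
      fps_nth (\<phi> ^ j * (1 - fps_deriv \<phi> * a)) j"
    by (simp add: n fps_X_power_mult_nth)
  show ?thesis
  proof (cases j)
    case 0
    with * show ?thesis
      by (simp add: n a0)
  next
    case (Suc m)
    have "\<phi> ^ j * (1 - fps_deriv \<phi> * a) = \<phi> ^ j - fps_X * (fps_deriv \<phi> * \<phi> ^ m)"
      by (simp add: Suc algebra_simps flip: \<phi>)
    then have "fps_nth (\<phi> ^ j * (1 - fps_deriv \<phi> * a)) j =
        fps_nth (\<phi> ^ j) j - fps_nth (fps_deriv \<phi> * \<phi> ^ m) m"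
      by (simp add: Suc)
    \<comment> \<open>Both sides are coefficient \<open>m\<close> of
      \<open>fps_deriv (\<phi> ^ j)\<close>; cancelling \<open>j\<close>, nonzero in characteristic
      0, makes the difference above vanish.\<close>
    moreover have "of_nat j * fps_nth (fps_deriv \<phi> * \<phi> ^ m) m = of_nat j * fps_nth (\<phi> ^ j) j"
    proof -
      have "fps_deriv (\<phi> ^ j) = fps_const (of_nat j) * (fps_deriv \<phi> * \<phi> ^ m)"
        by (simp add: fps_deriv_power Suc mult.assoc del: power_Suc)
      then have "fps_nth (fps_deriv (\<phi> ^ j)) m = of_nat j * fps_nth (fps_deriv \<phi> * \<phi> ^ m) m"
        by simp
      then show ?thesis
        by (simp add: Suc del: power_Suc of_nat_Suc)
    qed
    ultimately show ?thesis
      using * Suc n by (simp del: power_Suc of_nat_Suc)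
  qed
qed

theorem fps_lagrange_inversion:
  fixes a \<phi> :: "'a::field_char_0 fps"
  assumes a0: "fps_nth a 0 = 0" and a1: "fps_nth a 1 \<noteq> 0" and \<phi>: "\<phi> * a = fps_X"
    and "0 < k" and "k \<le> n"
  shows "of_nat n * fps_nth (fps_inv a ^ k) n = of_nat k * fps_nth (\<phi> ^ n) (n - k)"
proof -
  obtain N where n: "n = Suc N"
    using assms by (cases n) auto
  obtain K where k: "k = Suc K"
    using assms by (cases k) auto
  let ?g = "fps_inv a ^ k"
  have "?g oo a = fps_X ^ k"
    using fps_compose_power[OF a0, of "fps_inv a" k] fps_inv[OF a0 a1] by simp
  then have "(fps_deriv ?g oo a) * fps_deriv a = fps_deriv (fps_X ^ k)"
    using fps_compose_deriv[OF a0, of ?g] by simp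
  also have "\<dots> = fps_const (of_nat k) * fps_X ^ K"
    by (simp add: fps_deriv_power k del: power_Suc)
  finally have "(fps_deriv ?g oo a) * (fps_deriv a * \<phi> ^ n) =
      fps_const (of_nat k) * (fps_X ^ K * \<phi> ^ n)"
    by (metis mult.assoc)
  then have "fps_nth ((fps_deriv ?g oo a) * (fps_deriv a * \<phi> ^ n)) N =
      of_nat k * fps_nth (fps_X ^ K * \<phi> ^ n) N"
    by (simp only: fps_mult_left_const_nth)
  also have "\<dots> = of_nat k * fps_nth (\<phi> ^ n) (n - k)"
    using \<open>k \<le> n\<close> by (simp add: fps_X_power_mult_nth n k del: power_Suc of_nat_Suc)
  finally have "fps_nth ((fps_deriv ?g oo a) * (fps_deriv a * \<phi> ^ n)) N =
      of_nat k * fps_nth (\<phi> ^ n) (n - k)" .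
  \<comment> \<open>Only the term \<open>i = N\<close> survives, and coefficient \<open>N\<close> of
    \<open>fps_deriv ?g\<close> is \<open>n\<close> times coefficient \<open>n\<close> of
    \<open>?g\<close>.\<close>
  moreover have "fps_nth ((fps_deriv ?g oo a) * (fps_deriv a * \<phi> ^ n)) N =
      (\<Sum>i\<le>N. fps_nth (fps_deriv ?g) i * (if i = N then 1 else 0))"
    unfolding fps_compose_mult_nth[OF a0] n
    by (intro sum.cong refl arg_cong2[where f = times] fps_residue_power_deriv a0 \<phi>) auto
  ultimately show ?thesis
    by (simp add: n if_distrib cong: if_cong del: power_Suc of_nat_Suc)
qed

lemma fps_inv_unique:
  fixes a g :: "'a::field fps"
  assumes a0: "fps_nth a 0 = 0" and a1: "fps_nth a 1 \<noteq> 0" and g: "g oo a = fps_X"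
  shows "fps_inv a = g"
proof -
  have inv0: "fps_nth (fps_inv a) 0 = 0"
    by (simp add: fps_inv_def)
  have "g = g oo (a oo fps_inv a)"
    by (simp add: fps_inv_right[OF a0 a1])
  also have "\<dots> = fps_inv a"
    by (simp add: fps_compose_assoc[OF inv0 a0] g inv0)
  finally show ?thesis ..
qed

text \<open>Substituting \<open>- fps_X\<close> turns \<open>fps_inv a oo a\<close> into
  \<open>- fps_X\<close>, and the outer minus restores \<open>fps_X\<close>.\<close>

lemma fps_inv_compose_uminus_X:
  fixes a :: "'a::field fps"
  assumes a0: "fps_nth a 0 = 0" and a1: "fps_nth a 1 \<noteq> 0"
  shows "fps_inv (a oo - fps_X) = - fps_inv a"
proof (rule fps_inv_unique)
  have "- fps_inv a oo (a oo - fps_X) = - ((fps_inv a oo a) oo - fps_X)"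
    by (simp add: fps_compose_assoc a0 fps_compose_uminus)
  then show "- fps_inv a oo (a oo - fps_X) = fps_X"
    by (simp add: fps_inv[OF a0 a1])
qed (use assms in \<open>simp_all add: fps_compose_uminus'\<close>)

text \<open>Provides the \<open>\<phi>\<close> of Lagrange inversion: \<open>a\<close> has subdegree
  one, so it divides \<open>fps_X\<close> exactly.\<close>

lemma fps_X_divide_mult_self:
  fixes a :: "'a::field fps"
  assumes "fps_nth a 0 = 0" and "fps_nth a 1 \<noteq> 0"
  shows "fps_X / a * a = fps_X"
proof -
  have "subdegree a = 1"
    by (rule subdegreeI) (use assms in auto)
  moreover have "a \<noteq> 0"
    using assms by auto
  ultimately show ?thesis
    by (intro dvd_div_mult_self) (simp add: fps_dvd_iff)
qed

lemma prob_deg_stirling1_eq_binom_bernoulli: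
  assumes "prob_space M" and "(LINT \<omega>|M. X \<omega>) \<noteq> 0" and "k \<le> n"
  shows "prob_deg_stirling1 M X \<mu> n k =
    real (binom_pred n k) * prob_deg_bernoulli M X \<mu> n (n - k)"
proof (cases "k = 0")
  \<comment> \<open>Lagrange inversion needs \<open>0 < k\<close>; here both sides are 1 for
    \<open>n = 0\<close> and 0 otherwise, by the convention in \<open>binom_pred\<close>.\<close>
  case True
  then show ?thesis
    by (auto simp: prob_deg_stirling1_def prob_deg_bernoulli_def binom_pred_def)
next
  case False
  then obtain N K where nk: "n = Suc N" "k = Suc K" "K \<le> N"
    using \<open>k \<le> n\<close> by (cases n; cases k) auto
  let ?a = "delta_fps M X \<mu>" let ?\<phi> = "fps_X / ?a"
  have a: "fps_nth ?a 0 = 0" "fps_nth ?a 1 \<noteq> 0"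
    using assms delta_fps_nth_0 delta_fps_nth_1 by metis+
  have "real n * fps_nth (fps_inv ?a ^ k) n = real k * fps_nth (?\<phi> ^ n) (n - k)"
    using False \<open>k \<le> n\<close> fps_lagrange_inversion[OF a fps_X_divide_mult_self[OF a]] by simp
  then have "fps_nth (fps_inv ?a ^ k) n = real k / real n * fps_nth (?\<phi> ^ n) (n - k)"
    using nk by (simp add: field_simps del: of_nat_Suc power_Suc)
  moreover have "fact n / fact k * (real k / real n) = real (binom_pred n k) * fact (n - k)"
    using nk by (simp add: binom_pred_def binomial_fact divide_simps del: of_nat_Suc)
  moreover have "prob_deg_stirling1 M X \<mu> n k = fact n / fact k * fps_nth (fps_inv ?a ^ k) n"
    by (simp add: prob_deg_stirling1_def)
  ultimately show ?thesis
    by (metis (no_types, lifting) prob_deg_bernoulli_def delta_fps_def mult.assoc)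
qed

text \<open>This is the case \<open>k = 1\<close> of the preceding formula, where the binomial
  factor is 1. It makes the Bell polynomial at these arguments a Stirling number by
  definition.\<close>

lemma bernoulli_egf_eq_fps_inv:
  assumes "prob_space M" and "(LINT \<omega>|M. X \<omega>) \<noteq> 0"
  shows "Abs_fps (\<lambda>m. if m = 0 then 0 else prob_deg_bernoulli M X \<mu> m (m - 1) / fact m) =
    fps_inv (delta_fps M X \<mu>)"
proof (rule fps_ext)
  fix m
  show "fps_nth (Abs_fps (\<lambda>m. if m = 0 then 0
      else prob_deg_bernoulli M X \<mu> m (m - 1) / fact m)) m = fps_nth (fps_inv (delta_fps M X \<mu>)) m"
  proof (cases "m = 0")
    case True
    then show ?thesis
      by (simp add: fps_inv_def)
  next
    case False
    then show ?thesis
      using prob_deg_stirling1_eq_binom_bernoulli[OF assms, of 1 m \<mu>]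
      by (simp add: prob_deg_stirling1_def binom_pred_def field_simps)
  qed
qed

theorem theorem3p2:
  fixes M :: "'a measure" and Y :: "'a \<Rightarrow> real" and lam :: real and n k :: nat
  assumes "prob_space M"
    and "Y \<in> borel_measurable M"
    and "has_mgf M Y"
    and "(LINT \<omega>|M. Y \<omega>) \<noteq> 0"
    and "lam \<noteq> 0"
    and "k \<le> n"
  shows "prob_het_stirling1 M Y lam n k =
           partial_bell n k (\<lambda>m. - prob_deg_bernoulli M (\<lambda>\<omega>. - Y \<omega>) lam m (m - 1))
       \<and> prob_het_stirling1 M Y lam n k =
           partial_bell n k (\<lambda>m. prob_deg_bernoulli M Y (- lam) m (m - 1))
       \<and> prob_het_stirling1 M Y lam n k =
           (- 1) ^ k * real (binom_pred n k) * prob_deg_bernoulli M (\<lambda>\<omega>. - Y \<omega>) lam n (n - k)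
       \<and> prob_het_stirling1 M Y lam n k =
           (- 1) ^ k * prob_deg_stirling1 M (\<lambda>\<omega>. - Y \<omega>) lam n k
       \<and> prob_het_stirling1 M Y lam n k =
           real (binom_pred n k) * prob_deg_bernoulli M Y (- lam) n (n - k)
       \<and> prob_het_stirling1 M Y lam n k = prob_deg_stirling1 M Y (- lam) n k"
proof -
  let ?N = "\<lambda>\<omega>. - Y \<omega>"
  have N: "(LINT \<omega>|M. ?N \<omega>) \<noteq> 0"
    using assms(4) by simp
  have a: "fps_nth (delta_fps M ?N lam) 0 = 0" "fps_nth (delta_fps M ?N lam) 1 \<noteq> 0"
    using assms(1) N delta_fps_nth_0 delta_fps_nth_1 by metis+
  have het: "het_delta_fps M Y lam = delta_fps M Y (- lam)"
    by (simp add: het_delta_fps_def delta_fps_def)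
  have "delta_fps M Y (- lam) = delta_fps M ?N lam oo - fps_X"
    by (simp add: delta_fps_def exp_deg_fps_uminus fps_compose_sub_distrib)
  then have inv: "fps_inv (delta_fps M Y (- lam)) = - fps_inv (delta_fps M ?N lam)"
    using fps_inv_compose_uminus_X[OF a] by simp
  have Y: "prob_het_stirling1 M Y lam n k = prob_deg_stirling1 M Y (- lam) n k"
    by (simp add: prob_het_stirling1_def prob_deg_stirling1_def het)
  \<comment> \<open>Passing from \<open>Y\<close> to \<open>?N\<close> negates the compositional
    inverse, so its power \<open>k\<close> contributes the sign.\<close>
  have "(- f) ^ k = fps_const ((- 1) ^ k) * f ^ k" for f :: "real fps"
    by (subst power_minus) (simp flip: fps_const_power fps_const_neg)
  then have minus_Y: "prob_het_stirling1 M Y lam n k = (- 1) ^ k * prob_deg_stirling1 M ?N lam n k"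
    by (simp add: prob_het_stirling1_def prob_deg_stirling1_def het inv)
  have bell_Y: "prob_het_stirling1 M Y lam n k =
      partial_bell n k (\<lambda>m. prob_deg_bernoulli M Y (- lam) m (m - 1))"
    unfolding partial_bell_def bernoulli_egf_eq_fps_inv[OF assms(1,4)] prob_het_stirling1_def het ..
  have "Abs_fps (\<lambda>m. if m = 0 then 0 else - prob_deg_bernoulli M ?N lam m (m - 1) / fact m) =
      - fps_inv (delta_fps M ?N lam)"
    unfolding bernoulli_egf_eq_fps_inv[OF assms(1) N, symmetric] by (rule fps_ext) simp
  then have bell_minus_Y: "prob_het_stirling1 M Y lam n k =
      partial_bell n k (\<lambda>m. - prob_deg_bernoulli M ?N lam m (m - 1))"
    unfolding partial_bell_def prob_het_stirling1_def het inv by (simp only:)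
  show ?thesis
    using bell_minus_Y bell_Y minus_Y Y
      prob_deg_stirling1_eq_binom_bernoulli[OF assms(1) N assms(6), of lam]
      prob_deg_stirling1_eq_binom_bernoulli[OF assms(1,4,6), of "- lam"]
    by (metis mult.assoc)
qed

end
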